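(* Let $f\in C([0,1])$ satisfy $f(0)=f(1)=0$ and suppose there is $k>0$ with $|f(s)|\le ks$ and $|f(s)|\le k(1-s)$ for every $s\in[0,1]$. Let $f$ be of type B, i.e. there exists $\alpha\in(0,1)$ with $f=0$ on $[0,\alpha]$ and $f>0$ on $(\alpha,1)$, and assume that $f|_{[\alpha,1]}$ is locally Lipschitz continuous and has a unique local maximum point in $(\alpha,1)$. For $\varepsilon>0$ let $c^*_\varepsilon$ be the critical speed for $$\varepsilon\left(\frac{v'}{\sqrt{1-(v')^2}}\right)'-c\,v'+f(v)=0,\qquad(\ast)$$ and let $v_\varepsilon$ be the critical profile with $v_\varepsilon(0)=\mathcal{V}_0$, where $\mathcal{V}_0=\alpha$. Let $F(v)=\int_0^vf(s)\,ds$. Then, for $\varepsilon\to0^+$, it holds that $c^*_\varepsilon\to f(v_+)$, where $v_+\in(0,1)$ is the largest solution of the equation $F(v)=vf(v)$, and $v_\varepsilon\to\bar v$ uniformly in $\mathbb{R}$, where $$\bar v(z)=\begin{cases}\mathcal{V}_L(z;0,\mathcal{V}_0)& z\in(-\infty,v_+-\mathcal{V}_0]\\ \mathcal{V}_I(z;v_+-\mathcal{V}_0,v_+)& z\in(v_+-\mathcal{V}_0,+\infty).\end{cases}$$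
   Context: A heteroclinic solution of $(\ast)$ is a monotone $C^2$ solution $v:\mathbb{R}\to[0,1]$ (with $|v'|<1$) such that $v(-\infty)=0$, $v(+\infty)=1$. For $f$ of type B, there is a unique speed $c=c^*_\varepsilon\in\mathbb{R}$ for which such a solution exists (equivalently, for which the problem $y'=c\,\frac{\sqrt{y(2\varepsilon+y)}}{\varepsilon+y}-f(v)$, $y(0)=y(1)=0$, $y>0$ on $(0,1)$ is solvable), called the critical speed; the corresponding heteroclinic, unique up to translations in $z$, is the critical profile. For $\underline z\in\mathbb{R}$ and $\underline v\in(0,1)$, $$\mathcal{V}_L(z;\underline z,\underline v)=\begin{cases}0& z\in(-\infty,\underline z-\underline v)\\ z-\underline z+\underline v& z\in[\underline z-\underline v,1+\underline z-\underline v]\\ 1& z\in(1+\underline z-\underline v,+\infty),\end{cases}$$ and $\mathcal{V}_I(\cdot;\underline z,\underline v)$ is the (positive) solution of the inviscid problem $\bar c\,v'=f(v)$, $v(\underline z)=\underline v$, where $\bar c=\lim_{\varepsilon\to0^+}c^*_\varepsilon$ (so $\bar c=f(v_+)$). *)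

theory Defs
  imports "HOL-Analysis.Analysis"
begin

text \<open>
  Reaction terms are total functions on the reals; every notion below evaluates them on
  the unit interval only, so the values outside are irrelevant.
\<close>

definition type_B :: "(real \<Rightarrow> real) \<Rightarrow> real \<Rightarrow> bool" where
  "type_B f \<alpha> \<longleftrightarrow>
     0 < \<alpha> \<and> \<alpha> < 1 \<and> (\<forall>s\<in>{0..\<alpha>}. f s = 0) \<and> (\<forall>s\<in>{\<alpha><..<1}. f s > 0)"

definition local_max_point :: "(real \<Rightarrow> real) \<Rightarrow> real \<Rightarrow> bool" where
  "local_max_point f s \<longleftrightarrow> (\<forall>\<^sub>F t in nhds s. f t \<le> f s)"

definition C2 :: "(real \<Rightarrow> real) \<Rightarrow> bool" where
  "C2 v \<longleftrightarrow> (\<forall>z. v differentiable (at z)) \<and> (\<forall>z. deriv v differentiable (at z)) \<and>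
     continuous_on UNIV (deriv (deriv v))"

text \<open>
  The limits 0 and 1 at the two ends leave nondecreasing as the only possible meaning of
  ``monotone''.
\<close>

definition heteroclinic :: "(real \<Rightarrow> real) \<Rightarrow> real \<Rightarrow> real \<Rightarrow> (real \<Rightarrow> real) \<Rightarrow> bool" where
  "heteroclinic f \<epsilon> c v \<longleftrightarrow>
     C2 v \<and> mono v \<and> (\<forall>z. v z \<in> {0..1}) \<and> (\<forall>z. \<bar>deriv v z\<bar> < 1) \<and>
     (\<forall>z. \<epsilon> * deriv (\<lambda>x. deriv v x / sqrt (1 - (deriv v x)\<^sup>2)) z - c * deriv v z + f (v z) = 0) \<and>
     (v \<longlongrightarrow> 0) at_bot \<and> (v \<longlongrightarrow> 1) at_top"

definition critical_speed :: "(real \<Rightarrow> real) \<Rightarrow> real \<Rightarrow> real" where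
  "critical_speed f \<epsilon> = (THE c. \<exists>v. heteroclinic f \<epsilon> c v)"

definition critical_profile :: "(real \<Rightarrow> real) \<Rightarrow> real \<Rightarrow> (real \<Rightarrow> real) \<Rightarrow> bool" where
  "critical_profile f \<epsilon> v \<longleftrightarrow> heteroclinic f \<epsilon> (critical_speed f \<epsilon>) v"

definition primitive :: "(real \<Rightarrow> real) \<Rightarrow> real \<Rightarrow> real" where
  "primitive f v = integral {0..v} f"

text \<open>
  On \<open>{0<..\<alpha>}\<close> both sides of the equation vanish, so only the largest solution is of interest.
\<close>

definition largest_solution :: "(real \<Rightarrow> real) \<Rightarrow> real \<Rightarrow> bool" where
  "largest_solution f w \<longleftrightarrow>
     w \<in> {0<..<1} \<and> primitive f w = w * f w \<and>
     (\<forall>u\<in>{0<..<1}. primitive f u = u * f u \<longrightarrow> u \<le> w)"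

definition V_L :: "real \<Rightarrow> real \<Rightarrow> real \<Rightarrow> real" where
  "V_L z z0 v0 =
     (if z < z0 - v0 then 0 else if z \<le> 1 + z0 - v0 then z - z0 + v0 else 1)"

definition inviscid_speed :: "(real \<Rightarrow> real) \<Rightarrow> real" where
  "inviscid_speed f = Lim (at_right 0) (critical_speed f)"

definition inviscid_solution ::
    "(real \<Rightarrow> real) \<Rightarrow> real \<Rightarrow> real \<Rightarrow> real \<Rightarrow> (real \<Rightarrow> real) \<Rightarrow> bool" where
  "inviscid_solution f c z0 v0 v \<longleftrightarrow>
     (\<forall>z. 0 < v z \<and> v z \<le> 1) \<and> (\<forall>z. v differentiable (at z)) \<and>
     (\<forall>z. c * deriv v z = f (v z)) \<and> v z0 = v0"

definition V_I :: "(real \<Rightarrow> real) \<Rightarrow> real \<Rightarrow> real \<Rightarrow> real \<Rightarrow> real" where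
  "V_I f z z0 v0 = (THE v. inviscid_solution f (inviscid_speed f) z0 v0 v) z"

definition limit_profile :: "(real \<Rightarrow> real) \<Rightarrow> real \<Rightarrow> real \<Rightarrow> real \<Rightarrow> real" where
  "limit_profile f V0 w z =
     (if z \<le> w - V0 then V_L z 0 V0 else V_I f z (w - V0) w)"

end

theory Submission
  imports Defs
begin

text \<open>
  Fix \<open>\<epsilon>\<close>, and write \<open>v\<close> for the profile, \<open>c\<close> for its speed, \<open>F\<close> for the primitive of \<open>f\<close>,
  \<open>w\<close> for the largest solution of \<open>F u = u f u\<close>, and \<open>C = f w\<close>. Since \<open>f\<close> has a single
  interior maximum, \<open>w\<close> lies to the right of it, and \<open>C\<close> is the maximum of \<open>F u / u\<close>.

  The equation is that of a relativistic particle. Its kinetic energy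
  \<open>E = \<epsilon> (1 / sqrt (1 - v'\<^sup>2) - 1)\<close> satisfies \<open>E = c v - F v - D\<close>, where the loss \<open>D\<close> has
  derivative \<open>c v' (1 - v')\<close> and lies between \<open>0\<close> and \<open>\<epsilon>\<close> on the half-line \<open>z \<le> 0\<close>, where
  the reaction vanishes. From \<open>E \<ge> 0\<close> and \<open>D \<ge> 0\<close> one gets \<open>c \<ge> C\<close> (\<open>speed_lower\<close>). Moreover
  \<open>1 - v' \<le> (\<epsilon> / \<eta>)\<^sup>2\<close> wherever \<open>E \<ge> \<eta>\<close>, so \<open>D\<close> hardly grows while \<open>E\<close> is not small;
  hence \<open>E\<close> stays away from \<open>0\<close> as long as \<open>c v - F v\<close> clearly exceeds the initial loss
  (\<open>energy_stays_above\<close>). As \<open>v\<close> is bounded, it cannot do so forever (\<open>energy_drops\<close>). This has three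
  consequences for small \<open>\<epsilon>\<close>: the speed cannot exceed \<open>C\<close> by a fixed amount
  (\<open>speed_upper\<close>); the slope is close to \<open>1\<close> while \<open>v\<close> is in a compact part of \<open>(0, w)\<close>
  (\<open>slope_estimate\<close>), which gives the linear branch; and \<open>E\<close> is small once \<open>v\<close> has come near \<open>w\<close>
  (\<open>energy_past_w\<close>, \<open>energy_before_w\<close>).

  When \<open>E\<close> is small, so is the momentum, and the integrated equation says that \<open>v\<close> solves the integrated
  inviscid equation up to a small error. On the values beyond \<open>s\<close>, the maximum point, \<open>f\<close> is decreasing, so
  the difference between \<open>v\<close> and the inviscid solution obeys a one-sided comparison principle
  whose bound is uniform on the whole half-line (\<open>right_estimate\<close>).
\<close>

section \<open>Two barrier lemmas on an interval\<close>

lemma compact_sublevel: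
  fixes e :: "real \<Rightarrow> real"
  assumes "continuous_on {a..b} e"
  shows "compact {r \<in> {a..b}. e r \<le> \<eta>}"
proof -
  have "closed ({a..b} \<inter> e -` {..\<eta>})"
    using assms by (intro continuous_closed_preimage) auto
  then have "compact ({a..b} \<inter> ({a..b} \<inter> e -` {..\<eta>}))"
    by (intro compact_Int_closed) auto
  moreover have "{a..b} \<inter> ({a..b} \<inter> e -` {..\<eta>}) = {r \<in> {a..b}. e r \<le> \<eta>}" by auto
  ultimately show ?thesis by simp
qed

text \<open>A continuity argument: a lower bound that improves itself on every initial interval on which
  it holds never fails.\<close>

lemma stays_above:
  fixes e :: "real \<Rightarrow> real"
  assumes cont: "continuous_on {a..b} e" and start: "\<eta> < e a"
    and improve: "\<And>t. t \<in> {a..b} \<Longrightarrow> (\<And>r. r \<in> {a..t} \<Longrightarrow> \<eta> \<le> e r) \<Longrightarrow> \<eta> < e t"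
    and t: "t \<in> {a..b}"
  shows "\<eta> < e t"
proof (rule ccontr)
  assume "\<not> \<eta> < e t"
  define S where "S = {r \<in> {a..b}. e r \<le> \<eta>}"
  have "compact S" unfolding S_def by (rule compact_sublevel[OF cont])
  moreover have "t \<in> S" using t \<open>\<not> \<eta> < e t\<close> by (simp add: S_def)
  ultimately obtain r where r: "r \<in> S" "\<And>q. q \<in> S \<Longrightarrow> r \<le> q"
    using compact_attains_inf[of S] by blast
  have ab: "a \<le> r" "r \<le> b" and er: "e r \<le> \<eta>" using r(1) by (auto simp: S_def)
  have before: "\<eta> < e q" if "a \<le> q" "q < r" for q
    using r(2)[of q] that ab by (force simp: S_def)
  have "e r = \<eta>"
  proof (rule ccontr)
    assume "e r \<noteq> \<eta>"
    then have "e r < \<eta>" using er by simp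
    moreover have "continuous_on {a..r} e" using cont ab by (auto intro: continuous_on_subset)
    ultimately obtain q where "a \<le> q" "q \<le> r" "e q = \<eta>"
      using IVT2'[of e r \<eta> a] start ab by auto
    then show False using before[of q] \<open>e r < \<eta>\<close> by (cases "q = r") auto
  qed
  then have "\<eta> \<le> e q" if "q \<in> {a..r}" for q
    using before[of q] that by (cases "q = r") auto
  then show False using improve[of r] er ab by force
qed

text \<open>A one-sided comparison principle: \<open>Q\<close> is nearly a multiple of \<open>d\<close>, and is nonincreasing
  wherever \<open>d > 0\<close>. Only the behaviour after the last time with \<open>d \<le> 0\<close> matters, so the
  bound does not depend on the length of the interval.\<close>

lemma one_sided_comparison:
  fixes d Q q :: "real \<Rightarrow> real"
  assumes ab: "a \<le> b" and C: "C > 0" and cont: "continuous_on {a..b} d"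
    and der: "\<And>t. t \<in> {a..b} \<Longrightarrow> (Q has_real_derivative q t) (at t)"
    and sign: "\<And>t. t \<in> {a..b} \<Longrightarrow> d t > 0 \<Longrightarrow> q t \<le> 0"
    and close: "\<And>t. t \<in> {a..b} \<Longrightarrow> \<bar>Q t - C * d t\<bar> \<le> \<theta>"
    and start: "d a \<le> \<delta>" "0 \<le> \<delta>"
  shows "d b \<le> \<delta> + 2 * \<theta> / C"
proof -
  define S where "S = insert a {r \<in> {a..b}. d r \<le> 0}"
  have "compact S" unfolding S_def by (intro compact_insert compact_sublevel cont)
  then obtain r where r: "r \<in> S" "\<And>t. t \<in> S \<Longrightarrow> t \<le> r"
    using compact_attains_sup[of S] by (auto simp: S_def)
  have rab: "a \<le> r" "r \<le> b" and dr: "d r \<le> \<delta>" using r(1) start ab by (auto simp: S_def)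
  have pos: "d t > 0" if "r < t" "t \<le> b" for t
    using r(2)[of t] that rab by (force simp: S_def)
  have "Q b \<le> Q r"
  proof (rule DERIV_nonpos_imp_decreasing_open[OF rab(2)])
    fix x assume "r < x" "x < b"
    then show "\<exists>y. (Q has_real_derivative y) (at x) \<and> y \<le> 0"
      using der[of x] sign[of x] pos[of x] rab by (intro exI[of _ "q x"]) auto
  next
    show "continuous_on {r..b} Q"
    proof (rule DERIV_atLeastAtMost_imp_continuous_on)
      fix x assume "r \<le> x" "x \<le> b"
      then show "\<exists>y. (Q has_real_derivative y) (at x)" using der[of x] rab by (intro exI[of _ "q x"]) auto
    qed
  qed
  moreover have "C * d b \<le> Q b + \<theta>" using close[of b] ab by (simp add: abs_le_iff)
  moreover have "Q r \<le> C * d r + \<theta>" using close[of r] rab by (simp add: abs_le_iff)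
  moreover have "C * d r \<le> C * \<delta>" using dr C by simp
  ultimately have "C * d b \<le> C * \<delta> + 2 * \<theta>" by linarith
  then have "d b \<le> (C * \<delta> + 2 * \<theta>) / C" using C by (simp add: field_simps)
  then show ?thesis using C by (simp add: add_divide_distrib)
qed

section \<open>The inviscid equation\<close>

text \<open>The solution is the inverse of an antiderivative \<open>T\<close> of \<open>C / f\<close>. Since \<open>f\<close> vanishes
  at most linearly at both ends, \<open>T\<close> is unbounded there, at least as fast as a logarithm, so the
  solution is defined on the whole line.\<close>

lemma inviscid_solution_exists:
  fixes f :: "real \<Rightarrow> real"
  assumes cont: "continuous_on {\<alpha><..<\<beta>} f" and pos: "\<And>u. u \<in> {\<alpha><..<\<beta>} \<Longrightarrow> 0 < f u"
    and left: "\<And>u. u \<in> {\<alpha><..<\<beta>} \<Longrightarrow> f u \<le> L * (u - \<alpha>)"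
    and right: "\<And>u. u \<in> {\<alpha><..<\<beta>} \<Longrightarrow> f u \<le> L * (\<beta> - u)"
    and w: "w \<in> {\<alpha><..<\<beta>}" and C: "C > 0"
  obtains x where "\<And>z. x z \<in> {\<alpha><..<\<beta>}" "x z0 = w"
    "\<And>z. (x has_real_derivative f (x z) / C) (at z)"
proof -
  have L: "L > 0" using pos[OF w] right[OF w] w by (smt (verit) greaterThanLessThan_iff mult_nonpos_nonneg)
  have isc: "isCont (\<lambda>u. C / f u) u" if "\<alpha> < u" "u < \<beta>" for u
  proof -
    have "isCont f u" using cont that by (simp add: continuous_on_eq_continuous_at)
    then show ?thesis using pos[of u] that by (intro continuous_intros) auto
  qed
  have "\<exists>F. \<forall>u. ereal \<alpha> < u \<longrightarrow> u < ereal \<beta> \<longrightarrow> (F has_vector_derivative C / f u) (at u)"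
    using w isc by (intro einterval_antiderivative) auto
  then obtain F where F: "(F has_real_derivative C / f u) (at u)" if "\<alpha> < u" "u < \<beta>" for u
    by (auto simp: has_real_derivative_iff_has_vector_derivative)
  define T where "T u = F u - F w + z0" for u
  have T: "(T has_real_derivative C / f u) (at u)" if "\<alpha> < u" "u < \<beta>" for u
    unfolding T_def using F[OF that] by (auto intro!: derivative_eq_intros)
  have Tw: "T w = z0" by (simp add: T_def)
  have strict: "T a < T b" if "\<alpha> < a" "a < b" "b < \<beta>" for a b
  proof (rule DERIV_pos_imp_increasing[OF that(2)])
    fix u assume "a \<le> u" "u \<le> b"
    then show "\<exists>y. (T has_real_derivative y) (at u) \<and> y > 0"
      using T[of u] that pos[of u] C by (intro exI[of _ "C / f u"]) auto
  qed
  have Tcont: "continuous_on {\<alpha><..<\<beta>} T"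
    by (intro continuous_at_imp_continuous_on ballI, rule DERIV_isCont, rule T) auto
  have up: "\<exists>u. w \<le> u \<and> u < \<beta> \<and> z0 + n \<le> T u" if "n \<ge> 0" for n
  proof -
    \<comment> \<open>The logarithmic lower bound for \<open>T\<close> gains exactly \<open>n\<close> between \<open>w\<close> and this \<open>u\<close>.\<close>
    define u where "u = \<beta> - (\<beta> - w) * exp (- (L * n / C))"
    have "0 \<le> L * n / C" using L C that by simp
    then have e: "exp (- (L * n / C)) \<le> 1" by simp
    have "(\<beta> - w) * exp (- (L * n / C)) \<le> \<beta> - w"
      using mult_left_mono[OF e, of "\<beta> - w"] w by simp
    then have "w \<le> u" unfolding u_def by (simp only: algebra_simps)
    moreover have "u < \<beta>" using w unfolding u_def by auto
    ultimately have u: "w \<le> u" "u < \<beta>" .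
    have "T w + C / L * ln (\<beta> - w) \<le> T u + C / L * ln (\<beta> - u)"
    proof (rule DERIV_nonneg_imp_nondecreasing[OF u(1)])
      fix r assume r: "w \<le> r" "r \<le> u"
      have "((\<lambda>r. T r + C / L * ln (\<beta> - r)) has_real_derivative C / f r - C / (L * (\<beta> - r))) (at r)"
      proof -
        have "((\<lambda>r. ln (\<beta> - r)) has_real_derivative - 1 / (\<beta> - r)) (at r)"
          using r w u by (auto intro!: derivative_eq_intros)
        from DERIV_add[OF T DERIV_cmult[OF this, of "C / L"]] r w u show ?thesis by simp
      qed
      moreover have "C / (L * (\<beta> - r)) \<le> C / f r"
        using right[of r] pos[of r] r w u C by (intro divide_left_mono) auto
      ultimately show "\<exists>y. ((\<lambda>r. T r + C / L * ln (\<beta> - r)) has_real_derivative y) (at r) \<and> 0 \<le> y"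
        by (intro exI[of _ "C / f r - C / (L * (\<beta> - r))"]) auto
    qed
    moreover have "ln (\<beta> - u) = ln (\<beta> - w) - L * n / C"
      using w by (simp add: u_def ln_mult)
    then have "C / L * ln (\<beta> - u) = C / L * ln (\<beta> - w) - n" using L C by (simp add: right_diff_distrib)
    ultimately have "T w + n \<le> T u" by linarith
    then show ?thesis using u Tw by auto
  qed
  have down: "\<exists>u. \<alpha> < u \<and> u \<le> w \<and> T u \<le> z0 - n" if "n \<ge> 0" for n
  proof -
    define u where "u = \<alpha> + (w - \<alpha>) * exp (- (L * n / C))"
    have "0 \<le> L * n / C" using L C that by simp
    then have e: "exp (- (L * n / C)) \<le> 1" by simp
    have "(w - \<alpha>) * exp (- (L * n / C)) \<le> w - \<alpha>"
      using mult_left_mono[OF e, of "w - \<alpha>"] w by simp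
    then have "u \<le> w" unfolding u_def by (simp only: algebra_simps)
    moreover have "\<alpha> < u" using w unfolding u_def by auto
    ultimately have u: "u \<le> w" "\<alpha> < u" .
    have "T u - C / L * ln (u - \<alpha>) \<le> T w - C / L * ln (w - \<alpha>)"
    proof (rule DERIV_nonneg_imp_nondecreasing[OF u(1)])
      fix r assume r: "u \<le> r" "r \<le> w"
      have "((\<lambda>r. T r - C / L * ln (r - \<alpha>)) has_real_derivative C / f r - C / (L * (r - \<alpha>))) (at r)"
      proof -
        have "((\<lambda>r. ln (r - \<alpha>)) has_real_derivative 1 / (r - \<alpha>)) (at r)"
          using r w u by (auto intro!: derivative_eq_intros)
        from DERIV_diff[OF T DERIV_cmult[OF this, of "C / L"]] r w u show ?thesis by simp
      qed
      moreover have "C / (L * (r - \<alpha>)) \<le> C / f r"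
        using left[of r] pos[of r] r w u C by (intro divide_left_mono) auto
      ultimately show "\<exists>y. ((\<lambda>r. T r - C / L * ln (r - \<alpha>)) has_real_derivative y) (at r) \<and> 0 \<le> y"
        by (intro exI[of _ "C / f r - C / (L * (r - \<alpha>))"]) auto
    qed
    moreover have "ln (u - \<alpha>) = ln (w - \<alpha>) - L * n / C"
      using w by (simp add: u_def ln_mult)
    then have "C / L * ln (u - \<alpha>) = C / L * ln (w - \<alpha>) - n" using L C by (simp add: right_diff_distrib)
    ultimately have "T u \<le> T w - n" by linarith
    then show ?thesis using u Tw by auto
  qed
  have surj: "\<exists>u. \<alpha> < u \<and> u < \<beta> \<and> T u = z" for z
  proof (cases "z \<le> z0")
    case True
    then obtain a where a: "\<alpha> < a" "a \<le> w" "T a \<le> z" using down[of "z0 - z"] by auto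
    have "continuous_on {a..w} T" using Tcont a w by (auto intro: continuous_on_subset)
    then obtain u where "a \<le> u" "u \<le> w" "T u = z" using IVT'[of T a z w] a True Tw by auto
    then show ?thesis using a w by (intro exI[of _ u]) auto
  next
    case False
    then obtain b where b: "w \<le> b" "b < \<beta>" "z \<le> T b" using up[of "z - z0"] by auto
    have "continuous_on {w..b} T" using Tcont b w by (auto intro: continuous_on_subset)
    then obtain u where "w \<le> u" "u \<le> b" "T u = z" using IVT'[of T w z b] b False Tw by auto
    then show ?thesis using b w by (intro exI[of _ u]) auto
  qed
  then obtain x where x: "\<And>z. \<alpha> < x z" "\<And>z. x z < \<beta>" "\<And>z. T (x z) = z" by metis
  have inv: "x (T u) = u" if "\<alpha> < u" "u < \<beta>" for u
    using strict[of u "x (T u)"] strict[of "x (T u)" u] x that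
    by (metis less_irrefl linorder_less_linear)
  show thesis
  proof
    show "x z \<in> {\<alpha><..<\<beta>}" for z using x by simp
    show "x z0 = w" using inv[of w] w Tw by simp
    show "(x has_real_derivative f (x z) / C) (at z)" for z
    proof -
      have "(x has_derivative (*) (f (x z) / C)) (at z)"
      proof (rule has_derivative_inverse_strong_x[of "{\<alpha><..<\<beta>}" x z T "(*) (C / f (x z))"])
        show "(T has_derivative (*) (C / f (x z))) (at (x z))"
          using T[of "x z"] x by (simp add: has_field_derivative_def)
        show "(*) (C / f (x z)) \<circ> (*) (f (x z) / C) = id"
          using pos[of "x z"] x[of z] C by (auto simp: fun_eq_iff)
      qed (use x inv Tcont in auto)
      then show ?thesis by (simp add: has_field_derivative_def)
    qed
  qed
qed

text \<open>Gronwall's argument, applied to the squared distance of two solutions, in both directions of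
  time.\<close>

lemma inviscid_solution_unique:
  fixes f :: "real \<Rightarrow> real"
  assumes lip: "L-lipschitz_on {0..1} f" and C: "C > 0"
    and x: "inviscid_solution f C z0 w x" and y: "inviscid_solution f C z0 w y"
  shows "x = y"
proof
  fix z
  define K where "K = 2 * L / C"
  define h where "h t = (x t - y t)\<^sup>2" for t
  define h' where "h' t = 2 * (x t - y t) * (f (x t) - f (y t)) / C" for t
  have dx: "(x has_real_derivative f (x t) / C) (at t)" and dy: "(y has_real_derivative f (y t) / C) (at t)" for t
    using x y C unfolding inviscid_solution_def
    by (metis DERIV_deriv_iff_real_differentiable nonzero_mult_div_cancel_left less_irrefl)+
  have h: "(h has_real_derivative h' t) (at t)" for t
    unfolding h_def h'_def using dx[of t] dy[of t] C
    by (auto intro!: derivative_eq_intros simp: field_simps)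
  have K: "\<bar>h' t\<bar> \<le> K * h t" for t
  proof -
    have "x t \<in> {0..1}" "y t \<in> {0..1}" using x y unfolding inviscid_solution_def by (auto simp: less_imp_le)
    then have "\<bar>f (x t) - f (y t)\<bar> \<le> L * \<bar>x t - y t\<bar>"
      using lipschitz_onD[OF lip, of "x t" "y t"] by (simp add: dist_real_def)
    then have "\<bar>x t - y t\<bar> * \<bar>f (x t) - f (y t)\<bar> \<le> \<bar>x t - y t\<bar> * (L * \<bar>x t - y t\<bar>)"
      by (rule mult_left_mono) simp
    also have "\<dots> = L * h t" by (simp add: h_def power2_eq_square)
    finally have "\<bar>x t - y t\<bar> * \<bar>f (x t) - f (y t)\<bar> \<le> L * h t" .
    moreover have "\<bar>h' t\<bar> = 2 / C * (\<bar>x t - y t\<bar> * \<bar>f (x t) - f (y t)\<bar>)"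
      using C unfolding h'_def abs_mult abs_divide by simp
    moreover have "K * h t = 2 / C * (L * h t)" by (simp add: K_def)
    ultimately show ?thesis using C by (metis divide_nonneg_pos mult_left_mono zero_le_numeral)
  qed
  have h0: "h z0 = 0" using x y by (simp add: h_def inviscid_solution_def)
  have "h z \<le> 0"
  proof (cases "z \<ge> z0")
    case True
    have "h z * exp (- K * z) \<le> h z0 * exp (- K * z0)"
    proof (rule DERIV_nonpos_imp_nonincreasing[OF True])
      fix t
      have "((\<lambda>t. h t * exp (- K * t)) has_real_derivative (h' t - K * h t) * exp (- K * t)) (at t)"
        using h[of t] by (auto intro!: derivative_eq_intros simp: algebra_simps)
      moreover have "(h' t - K * h t) * exp (- K * t) \<le> 0"
        using K[of t] by (intro mult_nonpos_nonneg) auto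
      ultimately show "\<exists>y. ((\<lambda>t. h t * exp (- K * t)) has_real_derivative y) (at t) \<and> y \<le> 0" by blast
    qed
    then show ?thesis using h0 by (simp add: mult_le_0_iff)
  next
    case False
    then have le: "z \<le> z0" by simp
    have "h z * exp (K * z) \<le> h z0 * exp (K * z0)"
    proof (rule DERIV_nonneg_imp_nondecreasing[OF le])
      fix t
      have "((\<lambda>t. h t * exp (K * t)) has_real_derivative (h' t + K * h t) * exp (K * t)) (at t)"
        using h[of t] by (auto intro!: derivative_eq_intros simp: algebra_simps)
      moreover have "(h' t + K * h t) * exp (K * t) \<ge> 0"
        using K[of t] by (intro mult_nonneg_nonneg) auto
      ultimately show "\<exists>y. ((\<lambda>t. h t * exp (K * t)) has_real_derivative y) (at t) \<and> y \<ge> 0" by blast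
    qed
    then show ?thesis using h0 by (simp add: mult_le_0_iff)
  qed
  then show "x z = y z" by (simp add: h_def)
qed

section \<open>Shape of a reaction term with one interior maximum\<close>

text \<open>If monotonicity failed on one side of \<open>s\<close>, then a maximum of \<open>f\<close> over a shorter interval
  ending at an endpoint of \<open>[\<alpha>, \<beta>]\<close> would be attained at an interior point other than \<open>s\<close>, a second
  local maximum.\<close>

lemma unimodal:
  fixes f :: "real \<Rightarrow> real"
  assumes cont: "continuous_on {\<alpha>..\<beta>} f" and ends: "f \<alpha> = 0" "f \<beta> = 0"
    and pos: "\<And>u. u \<in> {\<alpha><..<\<beta>} \<Longrightarrow> 0 < f u"
    and uniq: "\<And>u. u \<in> {\<alpha><..<\<beta>} \<Longrightarrow> local_max_point f u \<Longrightarrow> u = s"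
    and s: "s \<in> {\<alpha><..<\<beta>}"
  shows "strict_mono_on {\<alpha>..s} f" and "strict_antimono_on {s..\<beta>} f"
proof -
  have interior: "u = s" if "a < u" "u < b" "\<alpha> \<le> a" "b \<le> \<beta>" "\<And>t. t \<in> {a..b} \<Longrightarrow> f t \<le> f u" for a b u
  proof (rule uniq)
    show "u \<in> {\<alpha><..<\<beta>}" using that by auto
    have "\<forall>\<^sub>F t in nhds u. t \<in> {a<..<b}" using that by (intro eventually_nhds_in_open) auto
    then show "local_max_point f u"
      unfolding local_max_point_def by (rule eventually_mono) (use that in auto)
  qed
  show "strict_mono_on {\<alpha>..s} f"
  proof (rule strict_mono_onI, rule ccontr)
    fix a b assume ab: "a \<in> {\<alpha>..s}" "b \<in> {\<alpha>..s}" "a < b" "\<not> f a < f b"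
    have "continuous_on {\<alpha>..b} f" using cont ab s by (auto intro: continuous_on_subset)
    then obtain u where u: "u \<in> {\<alpha>..b}" "\<And>t. t \<in> {\<alpha>..b} \<Longrightarrow> f t \<le> f u"
      using continuous_attains_sup[of "{\<alpha>..b}" f] ab by auto
    have "0 < f b" using pos[of b] ab s by auto
    then have "a \<noteq> \<alpha>" using ab ends by auto
    \<comment> \<open>If the maximum is attained at \<open>b\<close>, it is also attained at \<open>a\<close>, since \<open>f a \<ge> f b\<close>.\<close>
    define m where "m = (if u = b then a else u)"
    have max: "f t \<le> f m" if "t \<in> {\<alpha>..b}" for t
      using u(2)[OF that] ab by (auto simp: m_def)
    have "m \<noteq> \<alpha>" using max[of b] \<open>0 < f b\<close> ends ab by auto
    then have "m = s" using interior[of \<alpha> m b] max u ab s \<open>a \<noteq> \<alpha>\<close> by (auto simp: m_def split: if_splits)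
    then show False using u ab by (auto simp: m_def split: if_splits)
  qed
  show "strict_antimono_on {s..\<beta>} f"
  proof (rule monotone_onI, rule ccontr)
    fix a b assume ab: "a \<in> {s..\<beta>}" "b \<in> {s..\<beta>}" "a < b" "\<not> f b < f a"
    have "continuous_on {a..\<beta>} f" using cont ab s by (auto intro: continuous_on_subset)
    then obtain u where u: "u \<in> {a..\<beta>}" "\<And>t. t \<in> {a..\<beta>} \<Longrightarrow> f t \<le> f u"
      using continuous_attains_sup[of "{a..\<beta>}" f] ab by auto
    have "0 < f a" using pos[of a] ab s by auto
    then have "b \<noteq> \<beta>" using ab ends by auto
    define m where "m = (if u = a then b else u)"
    have max: "f t \<le> f m" if "t \<in> {a..\<beta>}" for t
      using u(2)[OF that] ab by (auto simp: m_def)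
    have "m \<noteq> \<beta>" using max[of a] \<open>0 < f a\<close> ends ab by auto
    then have "m = s" using interior[of a m \<beta>] max u ab s \<open>b \<noteq> \<beta>\<close> by (auto simp: m_def split: if_splits)
    then show False using u ab by (auto simp: m_def split: if_splits)
  qed
qed

lemma primitive_has_derivative:
  assumes "continuous_on {0..1} f" "u \<in> {0..1}"
  shows "(primitive f has_real_derivative f u) (at u within {0..1})"
  using integral_has_real_derivative[OF assms] by (simp add: primitive_def[abs_def])

lemma primitive_flat:
  assumes "\<And>r. r \<in> {0..u} \<Longrightarrow> f r = 0"
  shows "primitive f u = 0"
proof -
  have "integral {0..u} f = integral {0..u} (\<lambda>_. 0)" by (rule integral_cong) (rule assms)
  then show ?thesis by (simp add: primitive_def)
qed

lemma primitive_mvt: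
  assumes cont: "continuous_on {0..1} f" and ab: "0 \<le> a" "a < b" "b \<le> 1"
  shows "\<exists>\<xi>. a < \<xi> \<and> \<xi> < b \<and> primitive f b - primitive f a = (b - a) * f \<xi>"
proof -
  have "continuous_on {0..1} (primitive f)"
    using primitive_has_derivative[OF cont] by (rule DERIV_continuous_on)
  then have c: "continuous_on {a..b} (primitive f)" using ab by (auto intro: continuous_on_subset)
  have d: "(primitive f has_derivative (*) (f x)) (at x)" if "a < x" "x < b" for x
  proof -
    have "(primitive f has_real_derivative f x) (at x within {0<..<1})"
      by (rule DERIV_subset[OF primitive_has_derivative[OF cont]]) (use ab that in auto)
    then have "(primitive f has_real_derivative f x) (at x)"
      using ab that by (subst (asm) at_within_open) auto
    then show ?thesis by (simp add: has_field_derivative_def)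
  qed
  from mvt[OF ab(2) c d] obtain \<xi> where "a < \<xi>" "\<xi> < b" "primitive f b - primitive f a = f \<xi> * (b - a)"
    by blast
  then show ?thesis by (intro exI[of _ \<xi>]) (auto simp: mult.commute)
qed

text \<open>The standing hypotheses on \<open>f\<close>. The maximum is at \<open>s\<close>, and \<open>w\<close> is the point of
  \<open>(s, 1)\<close> where the mean value \<open>primitive f u / u\<close> is maximal; there it equals \<open>f w\<close>,
  the limit of the speeds. Nothing is said about \<open>f\<close> outside the unit interval.\<close>

locale reaction =
  fixes f :: "real \<Rightarrow> real" and \<alpha> s w :: real
  assumes cont: "continuous_on {0..1} f"
    and order: "0 < \<alpha>" "\<alpha> < s" "s < w" "w < 1"
    and zero: "\<And>u. u \<in> {0..\<alpha>} \<Longrightarrow> f u = 0" and pos: "\<And>u. u \<in> {\<alpha><..<1} \<Longrightarrow> 0 < f u"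
    and right_end: "f 1 = 0"
    and decreasing: "\<And>a b. s \<le> a \<Longrightarrow> a \<le> b \<Longrightarrow> b \<le> 1 \<Longrightarrow> f b \<le> f a"
    and tangent: "primitive f w = w * f w"
    and below: "\<And>u. u \<in> {0<..<w} \<Longrightarrow> primitive f u < f w * u"

text \<open>The function \<open>u * f u - primitive f u\<close> is positive on \<open>(\<alpha>, s]\<close>, where \<open>f\<close> increases,
  and negative at \<open>1\<close>; a zero \<open>w\<close> in between is the last one because \<open>f\<close> decreases after \<open>s\<close>.\<close>

lemma reaction_exists:
  assumes cont: "continuous_on {0..1} f" and f1: "f 1 = 0" and B: "type_B f \<alpha>"
    and s: "s \<in> {\<alpha><..<1}" and uniq: "\<And>u. u \<in> {\<alpha><..<1} \<Longrightarrow> local_max_point f u \<Longrightarrow> u = s"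
  obtains w where "reaction f \<alpha> s w" "largest_solution f w"
proof -
  have al: "0 < \<alpha>" "\<alpha> < 1" and zero: "\<And>u. u \<in> {0..\<alpha>} \<Longrightarrow> f u = 0"
    and pos: "\<And>u. u \<in> {\<alpha><..<1} \<Longrightarrow> 0 < f u"
    using B by (auto simp: type_B_def)
  let ?F = "primitive f"
  have "continuous_on {\<alpha>..1} f" using cont al by (auto intro: continuous_on_subset)
  note shape = unimodal[OF this zero[of \<alpha>] f1 pos uniq s]
  have inc: "strict_mono_on {\<alpha>..s} f" by (rule shape) (use al in auto)
  have dec: "strict_antimono_on {s..1} f" by (rule shape) (use al in auto)
  have inc: "f a < f b" if "\<alpha> \<le> a" "a < b" "b \<le> s" for a b
    using strict_mono_onD[OF inc, of a b] that by auto
  have dec: "f b < f a" if "s \<le> a" "a < b" "b \<le> 1" for a b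
    using monotone_onD[OF dec, of a b] that by auto
  have Fflat: "?F u = 0" if "u \<in> {0..\<alpha>}" for u
    using that by (intro primitive_flat zero) auto
  \<comment> \<open>Left of the maximum, \<open>f\<close> is increasing, so its mean value is below its value.\<close>
  have rise: "?F u < u * f u" if u: "\<alpha> < u" "u \<le> s" for u
  proof -
    obtain \<xi> where x: "\<alpha> < \<xi>" "\<xi> < u" "?F u - ?F \<alpha> = (u - \<alpha>) * f \<xi>"
      using primitive_mvt[OF cont, of \<alpha> u] u al s by auto
    have "?F u = (u - \<alpha>) * f \<xi>" using x Fflat[of \<alpha>] al by simp
    also have "\<dots> < u * f u" using x inc[of \<xi> u] pos[of \<xi>] that al s
      by (intro mult_strict_mono) auto
    finally show ?thesis .
  qed
  have F1: "0 < ?F 1"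
  proof -
    obtain \<xi> where x: "\<alpha> < \<xi>" "\<xi> < 1" "?F 1 - ?F \<alpha> = (1 - \<alpha>) * f \<xi>"
      using primitive_mvt[OF cont, of \<alpha> 1] al by auto
    then show ?thesis using Fflat[of \<alpha>] al pos[of \<xi>] by simp
  qed
  have Fcont: "continuous_on {0..1} ?F"
    using primitive_has_derivative[OF cont] by (rule DERIV_continuous_on)
  have "continuous_on {s..1} (\<lambda>u. u * f u - ?F u)"
    using cont Fcont s al by (intro continuous_intros) (auto intro: continuous_on_subset)
  then obtain w where w: "s \<le> w" "w \<le> 1" "w * f w - ?F w = 0"
    using IVT2'[of "\<lambda>u. u * f u - ?F u" 1 0 s] F1 f1 rise[of s] s by auto
  have "w \<noteq> s" "w \<noteq> 1" using w rise[of s] s F1 f1 by auto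
  then have sw: "s < w" "w < 1" using w by auto
  have above: "u * f u < ?F u" if u: "w < u" "u < 1" for u
  proof -
    obtain \<xi> where x: "w < \<xi>" "\<xi> < u" "?F u - ?F w = (u - w) * f \<xi>"
      using primitive_mvt[OF cont, of w u] u al s sw by auto
    have "(u - w) * f u \<le> (u - w) * f \<xi>" using dec[of \<xi> u] x that sw by (intro mult_left_mono) auto
    moreover have "w * f u < w * f w" using dec[of w u] that sw s al by auto
    ultimately show ?thesis using x w(3) by (simp add: algebra_simps)
  qed
  have below: "?F u < f w * u" if u: "u \<in> {0<..<w}" for u
  proof -
    have fw: "0 < f w" using pos[of w] sw s by auto
    consider "u \<le> \<alpha>" | "\<alpha> < u" "u \<le> s" "f u \<le> f w" | "\<alpha> < u" "f w < f u"
      using dec[of u w] u sw by force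
    then show ?thesis
    proof cases
      case 1
      then show ?thesis using Fflat[of u] u fw by auto
    next
      case 2
      have "u * f u \<le> u * f w" using 2 u by (intro mult_left_mono) auto
      then show ?thesis using rise[of u] 2 by (simp add: mult.commute)
    next
      case 3
      obtain \<xi> where x: "u < \<xi>" "\<xi> < w" "?F w - ?F u = (w - u) * f \<xi>"
        using primitive_mvt[OF cont, of u w] u sw by auto
      \<comment> \<open>By unimodality \<open>f\<close> stays above \<open>f w\<close> between \<open>u\<close> and \<open>w\<close>.\<close>
      have "f w < f \<xi>"
        using inc[of u \<xi>] dec[of \<xi> w] x sw 3 by (cases "\<xi> \<le> s") auto
      then have "(w - u) * f w < (w - u) * f \<xi>" using u by simp
      then show ?thesis using x w(3) by (simp add: algebra_simps)
    qed
  qed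
  show thesis
  proof
    show "reaction f \<alpha> s w"
    proof
      show "f b \<le> f a" if "s \<le> a" "a \<le> b" "b \<le> 1" for a b
        using dec[of a b] that by (cases "a = b") auto
    qed (use cont al s sw zero pos below w f1 in auto)
    show "largest_solution f w"
      unfolding largest_solution_def
    proof (intro conjI ballI impI)
      show "u \<le> w" if "u \<in> {0<..<1}" "?F u = u * f u" for u
        using above[of u] that by force
    qed (use w sw s al in auto)
  qed
qed

context reaction begin

abbreviation "F \<equiv> primitive f"
abbreviation "C \<equiv> f w"

lemma C_pos: "0 < C" using pos[of w] order by auto

lemma F_continuous: "continuous_on {0..1} F"
  using primitive_has_derivative[OF cont] by (rule DERIV_continuous_on)

lemma F_flat: assumes "0 \<le> u" "u \<le> \<alpha>" shows "F u = 0"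
  using assms by (intro primitive_flat zero) auto

lemma potential_increasing:
  assumes "w \<le> a" "a \<le> b" "b \<le> 1"
  shows "C * a - F a \<le> C * b - F b"
proof (cases "a = b")
  case False
  then obtain \<xi> where x: "a < \<xi>" "\<xi> < b" "F b - F a = (b - a) * f \<xi>"
    using primitive_mvt[OF cont, of a b] assms order by auto
  have "(b - a) * f \<xi> \<le> (b - a) * C"
    using decreasing[of w \<xi>] x assms order by (intro mult_left_mono) auto
  then show ?thesis using x by (simp add: algebra_simps)
qed simp

lemma potential_nonneg:
  assumes "0 \<le> u" "u \<le> 1"
  shows "F u \<le> C * u"
proof (cases "u < w")
  case True
  then show ?thesis using below[of u] assms F_flat[of 0] order by (cases "u = 0") auto
next
  case False
  then show ?thesis using potential_increasing[of w u] tangent assms by (simp add: mult.commute)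
qed

lemma potential_near_w:
  assumes M: "\<And>u. u \<in> {0..1} \<Longrightarrow> f u \<le> M" and u: "0 \<le> u" "u \<le> w"
  shows "C * u - F u \<le> M * (w - u)"
proof (cases "u = w")
  case False
  then obtain \<xi> where x: "u < \<xi>" "\<xi> < w" "F w - F u = (w - u) * f \<xi>"
    using primitive_mvt[OF cont, of u w] u order by auto
  have "(w - u) * f \<xi> \<le> (w - u) * M" using x u order by (intro mult_left_mono M) auto
  moreover have "C * u \<le> C * w" using C_pos u by simp
  ultimately show ?thesis using x tangent by (simp add: algebra_simps)
qed (simp add: tangent mult.commute)

end

section \<open>Energy of a travelling front\<close>

lemma constant_of_zero_derivative:
  fixes g :: "real \<Rightarrow> real"
  assumes "a \<le> b" "\<And>x. x \<le> b \<Longrightarrow> (g has_real_derivative 0) (at x)"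
  shows "g a = g b"
proof (rule antisym)
  show "g a \<le> g b" by (rule DERIV_nonneg_imp_nondecreasing[OF assms(1)]) (use assms(2) in blast)
  show "g b \<le> g a" by (rule DERIV_nonpos_imp_nonincreasing[OF assms(1)]) (use assms(2) in blast)
qed

text \<open>A front of speed \<open>c\<close> for a fixed \<open>\<epsilon>\<close>, normalised by \<open>v 0 = \<alpha>\<close>. That \<open>c\<close> is the only
  speed that admits a front plays no role.\<close>

locale front = reaction +
  fixes \<epsilon> c :: real and v :: "real \<Rightarrow> real"
  assumes eps: "0 < \<epsilon>" and het: "heteroclinic f \<epsilon> c v" and v0: "v 0 = \<alpha>"
begin

abbreviation "p \<equiv> deriv v"

text \<open>The relativistic momentum of a particle of mass \<open>\<epsilon>\<close> and velocity \<open>v'\<close> (speed of light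
  \<open>1\<close>), so that the equation reads \<open>momentum' = c v' - f v\<close>.\<close>

definition "momentum z = \<epsilon> * (p z / sqrt (1 - (p z)\<^sup>2))"

text \<open>The kinetic energy of that particle, normalised to vanish at rest.\<close>

definition "energy z = \<epsilon> * (1 / sqrt (1 - (p z)\<^sup>2) - 1)"

text \<open>The energy balance is \<open>energy' = c v'\<^sup>2 - f v v'\<close>. If \<open>v'\<^sup>2\<close> were \<open>v'\<close>, as
  it is at slope \<open>1\<close>, the energy would be \<open>c v - F v\<close>; the loss is what is missing, the integral of
  \<open>c v' (1 - v')\<close> up to \<open>z\<close>.\<close>

definition "loss z = c * v z - F (v z) - energy z"

lemma
  shows v_mono: "a \<le> b \<Longrightarrow> v a \<le> v b" and v_ge_0: "0 \<le> v z" and v_le_1: "v z \<le> 1"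
    and slope_bound: "\<bar>p z\<bar> < 1"
    and v_at_bot: "(v \<longlongrightarrow> 0) at_bot"
  using het by (auto simp: heteroclinic_def mono_def)

lemma v_has_derivative: "(v has_real_derivative p z) (at z)"
  using het by (auto simp: heteroclinic_def C2_def DERIV_deriv_iff_real_differentiable)

lemma slope_has_derivative: "(p has_real_derivative deriv p z) (at z)"
  using het by (auto simp: heteroclinic_def C2_def DERIV_deriv_iff_real_differentiable)

lemma slope_nonneg: "0 \<le> p z"
  using mono_on_imp_deriv_nonneg[of UNIV v "p z" z] v_mono v_has_derivative
  by (auto simp: monotone_on_def)

lemma v_gap:
  assumes "a \<le> b" and bounds: "\<And>z. z \<in> {a..b} \<Longrightarrow> q \<le> p z"
  shows "q * (b - a) \<le> v b - v a"
proof -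
  have "v a - q * a \<le> v b - q * b"
  proof (rule DERIV_nonneg_imp_nondecreasing[OF assms(1)])
    fix z assume "a \<le> z" "z \<le> b"
    then show "\<exists>y. ((\<lambda>z. v z - q * z) has_real_derivative y) (at z) \<and> 0 \<le> y"
      using v_has_derivative[of z] bounds[of z]
      by (intro exI[of _ "p z - q"]) (auto intro!: derivative_eq_intros)
  qed
  then show ?thesis by (simp add: algebra_simps)
qed

lemma v_lipschitz:
  assumes "a \<le> b"
  shows "v b - v a \<le> b - a"
proof -
  have "v b - b \<le> v a - a"
  proof (rule DERIV_nonpos_imp_nonincreasing[OF assms])
    fix z
    show "\<exists>y. ((\<lambda>z. v z - z) has_real_derivative y) (at z) \<and> y \<le> 0"
      using v_has_derivative[of z] slope_bound[of z]
      by (intro exI[of _ "p z - 1"]) (auto intro!: derivative_eq_intros)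
  qed
  then show ?thesis by simp
qed

lemma root_pos: "0 < sqrt (1 - (p z)\<^sup>2)"
  using slope_bound[of z] by (simp add: abs_square_less_1)

lemma root_le_1: "sqrt (1 - (p z)\<^sup>2) \<le> 1" by simp

lemma root_sq: "(sqrt (1 - (p z)\<^sup>2))\<^sup>2 = 1 - (p z)\<^sup>2"
  using root_pos[of z] by simp

lemma root_has_derivative:
  "((\<lambda>z. sqrt (1 - (p z)\<^sup>2)) has_real_derivative - (p z * deriv p z) / sqrt (1 - (p z)\<^sup>2)) (at z)"
  using root_pos[of z] slope_has_derivative[of z]
  by (auto intro!: derivative_eq_intros simp: field_simps)

lemma normalised_momentum_has_derivative:
  "((\<lambda>z. p z / sqrt (1 - (p z)\<^sup>2)) has_real_derivative deriv p z / sqrt (1 - (p z)\<^sup>2) ^ 3) (at z)"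
proof -
  let ?r = "sqrt (1 - (p z)\<^sup>2)"
  have "(deriv p z * ?r - p z * (- (p z * deriv p z) / ?r)) / (?r * ?r) = deriv p z * (?r\<^sup>2 + (p z)\<^sup>2) / ?r ^ 3"
    using root_pos[of z] by (simp add: field_simps power2_eq_square power3_eq_cube del: real_sqrt_mult_self)
  also have "?r\<^sup>2 + (p z)\<^sup>2 = 1" unfolding root_sq by simp
  finally show ?thesis
    using DERIV_divide[OF slope_has_derivative root_has_derivative, of z] root_pos[of z] by simp
qed

lemma momentum_has_derivative: "(momentum has_real_derivative c * p z - f (v z)) (at z)"
proof -
  have "\<epsilon> * deriv (\<lambda>z. p z / sqrt (1 - (p z)\<^sup>2)) z - c * p z + f (v z) = 0"
    using het by (simp add: heteroclinic_def)
  then have "\<epsilon> * (deriv p z / sqrt (1 - (p z)\<^sup>2) ^ 3) = c * p z - f (v z)"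
    using DERIV_imp_deriv[OF normalised_momentum_has_derivative[of z]] by simp
  then show ?thesis
    using DERIV_cmult[OF normalised_momentum_has_derivative, of \<epsilon> z] by (simp add: momentum_def[abs_def])
qed

lemma energy_has_derivative: "(energy has_real_derivative p z * (c * p z - f (v z))) (at z)"
proof -
  let ?r = "sqrt (1 - (p z)\<^sup>2)"
  have m: "\<epsilon> * (deriv p z / ?r ^ 3) = c * p z - f (v z)"
    using DERIV_unique[OF momentum_has_derivative[of z]]
      DERIV_cmult[OF normalised_momentum_has_derivative, of \<epsilon> z] by (simp add: momentum_def[abs_def])
  have "((\<lambda>z. 1 / sqrt (1 - (p z)\<^sup>2) - 1) has_real_derivative
      (0 * ?r - 1 * (- (p z * deriv p z) / ?r)) / (?r * ?r) - 0) (at z)"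
    using root_pos[of z] by (intro DERIV_diff DERIV_divide root_has_derivative DERIV_const) auto
  moreover have "(0 * r - 1 * (- (p z * deriv p z) / r)) / (r * r) - 0 = p z * (deriv p z / r ^ 3)" for r
    by (simp add: power3_eq_cube)
  ultimately have "((\<lambda>z. 1 / sqrt (1 - (p z)\<^sup>2) - 1) has_real_derivative p z * (deriv p z / ?r ^ 3)) (at z)"
    by (simp only:)
  from DERIV_cmult[OF this, of \<epsilon>] show ?thesis
    by (simp add: energy_def[abs_def] m[symmetric] mult.left_commute)
qed

lemma F_v_has_derivative: "((\<lambda>z. F (v z)) has_real_derivative f (v z) * p z) (at z)"
proof -
  have "range v \<subseteq> {0..1}" using v_ge_0 v_le_1 by auto
  then have "(F has_real_derivative f (v z)) (at (v z) within range v)"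
    by (rule DERIV_subset[OF primitive_has_derivative[OF cont], rotated]) (use v_ge_0 v_le_1 in auto)
  from DERIV_image_chain[OF this v_has_derivative] show ?thesis by (simp add: o_def)
qed

lemma loss_has_derivative: "(loss has_real_derivative c * p z * (1 - p z)) (at z)"
proof -
  have "(loss has_real_derivative c * p z - f (v z) * p z - p z * (c * p z - f (v z))) (at z)"
    unfolding loss_def[abs_def]
    by (intro DERIV_diff DERIV_cmult v_has_derivative F_v_has_derivative energy_has_derivative)
  then show ?thesis by (simp add: algebra_simps)
qed

lemma energy_continuous: "continuous_on S energy"
  by (intro continuous_at_imp_continuous_on ballI, rule DERIV_isCont, rule energy_has_derivative)

lemma energy_nonneg: "0 \<le> energy z"
  using eps root_pos[of z] root_le_1[of z] by (simp add: energy_def)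

lemma momentum_nonneg: "0 \<le> momentum z"
  using eps root_pos[of z] slope_nonneg[of z] by (simp add: momentum_def)

lemma energy_le_momentum: "energy z \<le> momentum z"
proof -
  let ?r = "sqrt (1 - (p z)\<^sup>2)"
  have "(1 - p z)\<^sup>2 \<le> ?r\<^sup>2"
    using slope_nonneg[of z] slope_bound[of z] mult_left_mono[of "p z" 1 "p z"] unfolding root_sq
    by (simp add: power2_eq_square algebra_simps)
  then have "1 - p z \<le> ?r" by (rule power2_le_imp_le[OF _ less_imp_le[OF root_pos]])
  then have "(1 - ?r) / ?r \<le> p z / ?r" using root_pos[of z] by (intro divide_right_mono) auto
  moreover have "(1 - ?r) / ?r = 1 / ?r - 1" using root_pos[of z] by (simp add: diff_divide_distrib)
  ultimately have "1 / ?r - 1 \<le> p z / ?r" by simp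
  then show ?thesis using eps unfolding energy_def momentum_def by (intro mult_left_mono) auto
qed

lemma momentum_le_energy: "momentum z \<le> energy z + \<epsilon>"
proof -
  have "p z / sqrt (1 - (p z)\<^sup>2) \<le> 1 / sqrt (1 - (p z)\<^sup>2)"
    using root_pos[of z] slope_bound[of z] by (intro divide_right_mono) auto
  then have "momentum z \<le> \<epsilon> * (1 / sqrt (1 - (p z)\<^sup>2))"
    using eps unfolding momentum_def by (intro mult_left_mono) auto
  then show ?thesis by (simp add: energy_def right_diff_distrib)
qed

text \<open>Where the energy is bounded below, the slope is close to the limiting value \<open>1\<close>.\<close>

lemma slope_near_1:
  assumes \<eta>: "0 < \<eta>" "\<eta> \<le> energy z"
  shows "1 - p z \<le> (\<epsilon> / \<eta>)\<^sup>2"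
proof -
  let ?r = "sqrt (1 - (p z)\<^sup>2)"
  have "\<eta> \<le> \<epsilon> / ?r" using \<eta> eps by (simp add: energy_def right_diff_distrib)
  then have "?r \<le> \<epsilon> / \<eta>" using root_pos[of z] \<eta> by (simp add: field_simps)
  then have "?r\<^sup>2 \<le> (\<epsilon> / \<eta>)\<^sup>2" using root_pos[of z] by (intro power_mono) auto
  moreover have "1 - p z \<le> 1 - (p z)\<^sup>2"
    using slope_nonneg[of z] slope_bound[of z] mult_left_mono[of "p z" 1 "p z"]
    by (simp add: power2_eq_square)
  ultimately show ?thesis unfolding root_sq by linarith
qed

text \<open>Left of the origin there is no reaction and the equation integrates to
  \<open>momentum = c v + K\<close>. As \<open>v\<close> tends to \<open>0\<close>, the constant \<open>K\<close> is the limit of the momentum; it is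
  nonnegative because the momentum is, and not positive because \<open>v\<close> is bounded.\<close>

lemma momentum_left:
  assumes "z \<le> 0"
  shows "momentum z = c * v z"
proof -
  have const: "momentum a - c * v a = momentum 0 - c * v 0" if "a \<le> 0" for a
  proof (rule constant_of_zero_derivative[OF that])
    fix x :: real assume "x \<le> 0"
    then have "f (v x) = 0" using v_mono[of x 0] v_ge_0[of x] v0 by (intro zero) auto
    then show "((\<lambda>z. momentum z - c * v z) has_real_derivative 0) (at x)"
      using DERIV_diff[OF momentum_has_derivative[of x] DERIV_cmult[OF v_has_derivative, of c x]] by simp
  qed
  define K where "K = momentum 0 - c * v 0"
  have K: "momentum a = c * v a + K" if "a \<le> 0" for a using const[OF that] by (simp add: K_def)
  have lim: "((\<lambda>z. c * v z + K) \<longlongrightarrow> K) at_bot"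
    using tendsto_add[OF tendsto_mult[OF tendsto_const[of c] v_at_bot] tendsto_const[of K]] by simp
  have "0 \<le> K"
  proof (rule tendsto_lowerbound[OF lim])
    show "\<forall>\<^sub>F z in at_bot. 0 \<le> c * v z + K"
      using eventually_le_at_bot[of 0] by eventually_elim (use K momentum_nonneg in metis)
  qed simp
  moreover have "\<not> 0 < K"
  proof
    assume K0: "0 < K"
    \<comment> \<open>The momentum, hence the slope, would stay away from \<open>0\<close> at \<open>-\<infinity>\<close>.\<close>
    obtain N where N: "\<And>z. z \<le> N \<Longrightarrow> K / 2 < c * v z + K"
      using order_tendstoD(1)[OF lim, of "K / 2"] K0 by (auto simp: eventually_at_bot_linorder)
    define q where "q = min (1 / 2) (K / (4 * \<epsilon>))"
    have q: "0 < q" using K0 eps by (simp add: q_def)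
    define b where "b = min N 0"
    have "q \<le> p z" if "z \<le> b" for z
    proof (rule ccontr)
      assume "\<not> q \<le> p z"
      then have small: "p z < 1 / 2" "p z < K / (4 * \<epsilon>)" by (auto simp: q_def)
      have "(p z)\<^sup>2 \<le> (1 / 2)\<^sup>2" using small slope_nonneg[of z] by (intro power_mono) auto
      then have "(1 / 2)\<^sup>2 \<le> (sqrt (1 - (p z)\<^sup>2))\<^sup>2" unfolding root_sq by (simp add: power2_eq_square)
      then have "1 / 2 \<le> sqrt (1 - (p z)\<^sup>2)" by (rule power2_le_imp_le[OF _ less_imp_le[OF root_pos]])
      then have "p z / sqrt (1 - (p z)\<^sup>2) \<le> p z / (1 / 2)"
        using slope_nonneg[of z] root_pos[of z] by (intro divide_left_mono) auto
      then have "p z / sqrt (1 - (p z)\<^sup>2) < K / (2 * \<epsilon>)" using small by simp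
      then have "momentum z < \<epsilon> * (K / (2 * \<epsilon>))"
        unfolding momentum_def using eps by (intro mult_strict_left_mono)
      then have "momentum z < K / 2" using eps by simp
      then show False using N[of z] K[of z] that by (simp add: b_def)
    qed
    then have "q * (b - (b - 2 / q)) \<le> v b - v (b - 2 / q)"
      using q by (intro v_gap) auto
    then show False using q v_le_1[of b] v_ge_0[of "b - 2 / q"] by simp
  qed
  ultimately show ?thesis using K[OF assms] by simp
qed

lemma speed_pos: "0 < c"
proof (rule ccontr)
  assume "\<not> 0 < c"
  have al: "0 < \<alpha>" using order by simp
  have "0 \<le> c * \<alpha>" using momentum_left[of 0] momentum_nonneg[of 0] v0 by simp
  then have "c = 0" using \<open>\<not> 0 < c\<close> al by (simp add: zero_le_mult_iff)
  have "p z = 0" if "z \<le> 0" for z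
    using momentum_left[OF that] \<open>c = 0\<close> eps root_pos[of z] by (simp add: momentum_def)
  then have "v z = v 0" if "z \<le> 0" for z
    using constant_of_zero_derivative[OF that, of v] v_has_derivative by metis
  then have "\<forall>\<^sub>F z in at_bot. v z = \<alpha>"
    unfolding eventually_at_bot_linorder using v0 by (intro exI[of _ 0]) simp
  then have "(v \<longlongrightarrow> \<alpha>) at_bot" by (rule tendsto_eventually)
  then show False using tendsto_unique[OF _ v_at_bot] al by (metis less_irrefl trivial_limit_at_bot_linorder)
qed

lemma loss_left:
  assumes "z \<le> 0"
  shows "0 \<le> loss z" and "loss z \<le> \<epsilon>"
proof -
  have "F (v z) = 0" using v_mono[OF assms] v_ge_0[of z] v0 by (intro F_flat) auto
  then have "loss z = momentum z - energy z" using momentum_left[OF assms] by (simp add: loss_def)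
  then show "0 \<le> loss z" "loss z \<le> \<epsilon>"
    using energy_le_momentum[of z] momentum_le_energy[of z] by simp_all
qed

lemma loss_nonneg: "0 \<le> loss z"
proof (cases "z \<le> 0")
  case False
  have "loss 0 \<le> loss z"
  proof (rule DERIV_nonneg_imp_nondecreasing[of 0 z loss])
    show "\<exists>y. (loss has_real_derivative y) (at x) \<and> 0 \<le> y" for x
      using loss_has_derivative[of x] speed_pos slope_nonneg[of x] slope_bound[of x]
      by (intro exI[of _ "c * p x * (1 - p x)"]) auto
  qed (use False in simp)
  then show ?thesis using loss_left(1)[of 0] by simp
qed (rule loss_left(1))

lemma loss_increment:
  assumes "a \<le> b" "0 < \<eta>" and E: "\<And>r. r \<in> {a..b} \<Longrightarrow> \<eta> \<le> energy r"
  shows "loss b \<le> loss a + c * (\<epsilon> / \<eta>)\<^sup>2"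
proof -
  let ?k = "(\<epsilon> / \<eta>)\<^sup>2"
  have "c * ?k * v a - loss a \<le> c * ?k * v b - loss b"
  proof (rule DERIV_nonneg_imp_nondecreasing[OF assms(1)])
    fix z assume z: "a \<le> z" "z \<le> b"
    have "((\<lambda>z. c * ?k * v z - loss z) has_real_derivative c * ?k * p z - c * p z * (1 - p z)) (at z)"
      by (intro DERIV_diff DERIV_cmult v_has_derivative loss_has_derivative)
    moreover have "c * p z * (1 - p z) \<le> c * p z * ?k"
      using speed_pos slope_nonneg[of z] slope_near_1[OF assms(2) E[of z]] z by (intro mult_left_mono) auto
    ultimately show "\<exists>y. ((\<lambda>z. c * ?k * v z - loss z) has_real_derivative y) (at z) \<and> 0 \<le> y"
      by (intro exI[of _ "c * ?k * p z - c * p z * (1 - p z)"]) (auto simp: mult_ac)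
  qed
  moreover have "c * ?k * (v b - v a) \<le> c * ?k * 1"
    using speed_pos v_ge_0[of a] v_le_1[of b] by (intro mult_left_mono) auto
  ultimately show ?thesis by (simp add: algebra_simps)
qed

text \<open>As long as the energy is at least \<open>\<eta>\<close> the loss grows by at most \<open>c (\<epsilon> / \<eta>)\<^sup>2\<close>, which
  in turn keeps the energy above \<open>\<eta>\<close>.\<close>

lemma energy_stays_above:
  assumes \<eta>: "0 < \<eta>"
    and H: "\<And>t. t \<in> {a..b} \<Longrightarrow> \<eta> + c * (\<epsilon> / \<eta>)\<^sup>2 + loss a < c * v t - F (v t)"
    and t: "t \<in> {a..b}"
  shows "\<eta> < energy t"
proof (rule stays_above[OF energy_continuous _ _ t])
  have "0 \<le> c * (\<epsilon> / \<eta>)\<^sup>2" using speed_pos by simp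
  then show "\<eta> < energy a" using H[of a] t by (simp add: loss_def)
  fix r assume r: "r \<in> {a..b}" "\<And>q. q \<in> {a..r} \<Longrightarrow> \<eta> \<le> energy q"
  have "loss r \<le> loss a + c * (\<epsilon> / \<eta>)\<^sup>2"
    using r by (intro loss_increment \<eta>) auto
  then show "\<eta> < energy r" using H[OF r(1)] by (simp add: loss_def)
qed

text \<open>An energy bounded below keeps the slope at \<open>1 / 2\<close> at least, which would carry \<open>v\<close> out of
  the unit interval.\<close>

lemma energy_drops:
  assumes \<eta>: "0 < \<eta>" and small: "(\<epsilon> / \<eta>)\<^sup>2 \<le> 1 / 2"
  shows "\<exists>t\<ge>a. energy t \<le> \<eta>"
proof (rule ccontr)
  assume "\<not> ?thesis"
  then have E: "\<eta> \<le> energy t" if "a \<le> t" for t using that by force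
  have "1 / 2 * ((a + 3) - a) \<le> v (a + 3) - v a"
  proof (rule v_gap)
    show "1 / 2 \<le> p z" if "z \<in> {a..a + 3}" for z
      using slope_near_1[OF \<eta> E[of z]] small that by simp
  qed simp
  then show False using v_ge_0[of a] v_le_1[of "a + 3"] by simp
qed

end

section \<open>Quantitative estimates for a front\<close>

context front begin

text \<open>Energy and loss are nonnegative, so \<open>F u \<le> c u\<close> for every \<open>u\<close> in the range of \<open>v\<close>;
  the strongest of these inequalities is the one for \<open>u = w\<close>.\<close>

lemma speed_lower: "C \<le> c"
proof -
  have "(v \<longlongrightarrow> 1) at_top" using het by (simp add: heteroclinic_def)
  then have "\<forall>\<^sub>F z in at_top. w < v z" using order by (intro order_tendstoD(1)) auto
  then obtain b where b: "0 \<le> b" "w < v b"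
    by (metis eventually_at_top_linorder linear order_refl)
  have "continuous_on {0..b} v"
    by (intro continuous_at_imp_continuous_on ballI, rule DERIV_isCont, rule v_has_derivative)
  then obtain z where z: "v z = w" using IVT'[of v 0 w b] b v0 order by auto
  have "w * C \<le> w * c"
    using loss_nonneg[of z] energy_nonneg[of z] tangent z by (simp add: loss_def mult.commute)
  then show ?thesis using order by simp
qed

text \<open>If the speed exceeded \<open>C\<close> by \<open>\<delta>\<close>, the gain \<open>c u - F u\<close> would be at least
  \<open>\<delta> \<alpha>\<close> on \<open>[\<alpha>, 1]\<close> and the energy could never decay.\<close>

lemma speed_upper:
  assumes \<delta>: "0 < \<delta>" and \<eta>: "\<eta> = \<delta> * \<alpha> / 2"
    and small: "(\<epsilon> / \<eta>)\<^sup>2 \<le> \<alpha> / 4" "C * (\<epsilon> / \<eta>)\<^sup>2 + \<epsilon> < \<alpha> * \<delta> / 4"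
  shows "c < C + \<delta>"
proof (rule ccontr)
  assume "\<not> c < C + \<delta>"
  then have cd: "\<delta> \<le> c - C" by simp
  let ?k = "(\<epsilon> / \<eta>)\<^sup>2"
  have al: "0 < \<alpha>" "\<alpha> < 1" using order by auto
  have \<eta>0: "0 < \<eta>" using \<delta> al by (simp add: \<eta>)
  have "\<delta> * \<alpha> \<le> (c - C) * \<alpha>" using cd al by (intro mult_right_mono) auto
  moreover have "(c - C) * ?k \<le> (c - C) * (\<alpha> / 4)" using small(1) cd \<delta> by (intro mult_left_mono) auto
  ultimately have budget: "\<eta> + c * ?k + \<epsilon> < (c - C) * \<alpha>"
    using small(2) unfolding \<eta> by (simp add: algebra_simps)
  have H: "\<eta> + c * ?k + loss 0 < c * v t - F (v t)" if "0 \<le> t" for t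
  proof -
    have "(c - C) * \<alpha> \<le> (c - C) * v t" using v_mono[OF that] v0 cd \<delta> by (intro mult_left_mono) auto
    then show ?thesis
      using budget loss_left(2)[of 0] potential_nonneg[OF v_ge_0[of t] v_le_1[of t]]
      by (simp add: algebra_simps)
  qed
  have "\<eta> < energy t" if "0 \<le> t" for t
    using H that by (intro energy_stays_above[where a = 0 and b = t] \<eta>0) auto
  moreover have "?k \<le> 1 / 2" using small(1) al by simp
  ultimately show False using energy_drops[OF \<eta>0, of 0] by force
qed

text \<open>On any range of values compactly inside \<open>(0, w)\<close> the gain \<open>C u - F u\<close> is bounded below, hence
  so is the energy, and the profile is nearly a line of slope \<open>1\<close>.\<close>

lemma slope_estimate:
  assumes \<theta>: "0 < \<theta>" "\<theta> \<le> \<alpha>" and m: "0 < m" "\<And>u. u \<in> {\<theta>..w - \<theta>} \<Longrightarrow> m \<le> C * u - F u"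
    and small: "c * (\<epsilon> / (m / 2))\<^sup>2 + \<epsilon> < m / 2"
    and z: "v z \<in> {\<theta>..w - \<theta>}"
  shows "1 - p z \<le> (\<epsilon> / (m / 2))\<^sup>2"
proof (rule slope_near_1)
  \<comment> \<open>The loss is at most \<open>\<epsilon>\<close> at any nonpositive starting point.\<close>
  let ?a = "min z 0"
  show "m / 2 \<le> energy z"
  proof (rule less_imp_le, rule energy_stays_above[where a = ?a and b = z])
    fix t assume t: "t \<in> {?a..z}"
    have "\<theta> \<le> v ?a" using z \<theta> v0 by (auto simp: min_def)
    then have "v t \<in> {\<theta>..w - \<theta>}" using v_mono[of ?a t] v_mono[of t z] t z by auto
    then have "m \<le> C * v t - F (v t)" by (rule m(2))
    moreover have "C * v t \<le> c * v t" using speed_lower v_ge_0 by (intro mult_right_mono) auto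
    moreover have "loss ?a \<le> \<epsilon>" by (rule loss_left(2)) simp
    ultimately show "m / 2 + c * (\<epsilon> / (m / 2))\<^sup>2 + loss ?a < c * v t - F (v t)"
      using small by linarith
  qed (use m in auto)
qed (use m in simp)

lemma left_estimate:
  assumes slope: "\<And>z. v z \<in> {\<theta>..w - \<theta>} \<Longrightarrow> 1 - p z \<le> k"
    and k: "0 \<le> k" "k \<le> 1 / 2" and \<theta>: "0 \<le> \<theta>" "\<theta> \<le> \<alpha>" "\<theta> \<le> w - \<alpha>" and z: "z \<le> w - \<alpha>"
  shows "\<bar>v z - max 0 (z + \<alpha>)\<bar> \<le> \<theta> + 2 * k"
proof (cases "z \<le> 0")
  case True
  have low: "max 0 (z + \<alpha>) \<le> v z" using v_lipschitz[OF True] v0 v_ge_0 by simp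
  have "v z \<le> max 0 (z + \<alpha>) + \<theta> + 2 * k"
  proof (cases "v z \<le> \<theta>")
    case False
    have "(1 - k) * (0 - z) \<le> v 0 - v z"
    proof (rule v_gap[OF True])
      fix t assume "t \<in> {z..0}"
      then have "v t \<in> {\<theta>..w - \<theta>}" using v_mono[of z t] v_mono[of t 0] False v0 \<theta> by auto
      then show "1 - k \<le> p t" using slope[of t] by simp
    qed
    then have gap: "v z \<le> \<alpha> + z - k * z" using v0 by (simp add: algebra_simps)
    have "1 / 2 * (- z) \<le> (1 - k) * (- z)" using k True by (intro mult_right_mono) auto
    also have "\<dots> \<le> 1" using gap v_ge_0[of z] order by (simp add: algebra_simps)
    finally have "k * (- z) \<le> k * 2" using k by (intro mult_left_mono) auto
    then show ?thesis using gap \<theta> by simp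
  qed (use k in simp)
  then show ?thesis using low by simp
next
  case False
  then have z0: "0 \<le> z" by simp
  have up: "v z \<le> z + \<alpha>" using v_lipschitz[OF z0] v0 by simp
  have "z + \<alpha> \<le> v z + \<theta> + 2 * k"
  proof (cases "v z \<le> w - \<theta>")
    case True
    have "(1 - k) * (z - 0) \<le> v z - v 0"
    proof (rule v_gap[OF z0])
      fix t assume "t \<in> {0..z}"
      then have "v t \<in> {\<theta>..w - \<theta>}" using v_mono[of 0 t] v_mono[of t z] True v0 \<theta> by auto
      then show "1 - k \<le> p t" using slope[of t] by simp
    qed
    moreover have "k * z \<le> k * 1" using k z order by (intro mult_left_mono) auto
    ultimately show ?thesis using v0 k \<theta> by (simp add: algebra_simps)
  qed (use z k in simp)
  moreover have "0 < \<alpha>" using order by simp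
  ultimately show ?thesis using up z0 k \<theta> by simp
qed

text \<open>Past \<open>w\<close> the potential \<open>C u - F u\<close> increases, so an energy that exceeds \<open>\<eta>\<close> there could
  never fall below \<open>\<eta> / 2\<close> again.\<close>

lemma energy_past_w:
  assumes \<eta>: "0 < \<eta>" and small: "c * (\<epsilon> / (\<eta> / 2))\<^sup>2 \<le> \<eta> / 2" "(\<epsilon> / (\<eta> / 2))\<^sup>2 \<le> 1 / 2"
    and z: "w \<le> v z"
  shows "energy z \<le> \<eta>"
proof (rule ccontr)
  assume big: "\<not> energy z \<le> \<eta>"
  have H: "\<eta> / 2 + c * (\<epsilon> / (\<eta> / 2))\<^sup>2 + loss z < c * v t - F (v t)" if "z \<le> t" for t
  proof -
    have "C * v z - F (v z) \<le> C * v t - F (v t)"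
      by (rule potential_increasing[OF z v_mono[OF that] v_le_1])
    moreover have "(c - C) * v z \<le> (c - C) * v t"
      using speed_lower v_mono[OF that] by (intro mult_left_mono) auto
    ultimately show ?thesis using big small(1) by (simp add: loss_def algebra_simps)
  qed
  have "\<eta> / 2 < energy t" if "z \<le> t" for t
    using H that \<eta> by (intro energy_stays_above[where a = z and b = t]) auto
  then show False using energy_drops[OF _ small(2), of z] \<eta> by force
qed

lemma energy_before_w:
  assumes M: "\<And>u. u \<in> {0..1} \<Longrightarrow> f u \<le> M" and z: "v z \<le> w"
  shows "energy z \<le> (c - C) + M * (w - v z)"
proof -
  have "(c - C) * v z \<le> (c - C) * 1" using speed_lower v_le_1 by (intro mult_left_mono) auto
  then show ?thesis
    using loss_nonneg[of z] potential_near_w[OF M v_ge_0 z] by (simp add: loss_def algebra_simps)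
qed

text \<open>To the right of \<open>w - \<alpha>\<close> the momentum is negligible, so \<open>v\<close> nearly solves the integrated
  inviscid equation. Both functions stay where \<open>f\<close> is decreasing, so their difference cannot
  grow.\<close>

lemma right_estimate:
  assumes x: "\<And>z. (x has_real_derivative f (x z) / C) (at z)" "x (w - \<alpha>) = w"
    and x_range: "\<And>z. w - \<alpha> \<le> z \<Longrightarrow> w \<le> x z \<and> x z \<le> 1"
    and \<rho>: "\<bar>v (w - \<alpha>) - w\<bar> \<le> \<rho>" "\<rho> \<le> w - s"
    and e: "\<And>z. w - \<alpha> \<le> z \<Longrightarrow> energy z \<le> e"
    and z: "w - \<alpha> \<le> z"
  shows "\<bar>v z - x z\<bar> \<le> \<rho> + 2 * ((c - C) + \<epsilon> + e) / C"
proof -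
  define Q where "Q z = c * v z - momentum z - C * x z" for z
  have Q: "(Q has_real_derivative f (v t) - f (x t)) (at t)" for t
  proof -
    have "(Q has_real_derivative c * p t - (c * p t - f (v t)) - C * (f (x t) / C)) (at t)"
      unfolding Q_def[abs_def]
      by (intro DERIV_diff DERIV_cmult v_has_derivative momentum_has_derivative x)
    then show ?thesis using C_pos by simp
  qed
  have close: "\<bar>Q t - C * (v t - x t)\<bar> \<le> (c - C) + \<epsilon> + e" if "w - \<alpha> \<le> t" for t
  proof -
    have "Q t - C * (v t - x t) = (c - C) * v t - momentum t" by (simp add: Q_def algebra_simps)
    moreover have "0 \<le> (c - C) * v t" using speed_lower v_ge_0 by simp
    moreover have "(c - C) * v t \<le> (c - C) * 1" using speed_lower v_le_1 by (intro mult_left_mono) auto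
    ultimately show ?thesis
      using momentum_le_energy[of t] momentum_nonneg[of t] e[OF that] energy_nonneg[of t] eps speed_lower
      by (simp add: abs_le_iff)
  qed
  have v_range: "s \<le> v t" if "w - \<alpha> \<le> t" for t
    using v_mono[OF that] \<rho> by (simp add: abs_le_iff)
  have cont: "continuous_on {w - \<alpha>..z} (\<lambda>t. v t - x t)" "continuous_on {w - \<alpha>..z} (\<lambda>t. x t - v t)"
    by (intro continuous_at_imp_continuous_on ballI isCont_diff;
        rule DERIV_isCont, (rule v_has_derivative | rule x))+
  have "0 \<le> \<rho>" using \<rho>(1) abs_ge_zero order_trans by blast
  have "v z - x z \<le> \<rho> + 2 * ((c - C) + \<epsilon> + e) / C"
  proof (rule one_sided_comparison[OF z C_pos cont(1), where Q = Q and q = "\<lambda>t. f (v t) - f (x t)"])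
    fix t assume t: "t \<in> {w - \<alpha>..z}"
    show "f (v t) - f (x t) \<le> 0" if "0 < v t - x t"
      using decreasing[of "x t" "v t"] x_range[of t] t that v_le_1[of t] order by auto
  qed (use Q close \<rho> x \<open>0 \<le> \<rho>\<close> in \<open>auto simp: abs_le_iff\<close>)
  moreover have "x z - v z \<le> \<rho> + 2 * ((c - C) + \<epsilon> + e) / C"
  proof (rule one_sided_comparison[OF z C_pos cont(2), where Q = "\<lambda>t. - Q t" and q = "\<lambda>t. - (f (v t) - f (x t))"])
    fix t assume t: "t \<in> {w - \<alpha>..z}"
    show "- (f (v t) - f (x t)) \<le> 0" if "0 < x t - v t"
      using decreasing[of "v t" "x t"] x_range[of t] t that v_range[of t] by auto
    show "((\<lambda>t. - Q t) has_real_derivative - (f (v t) - f (x t))) (at t)"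
      using Q by (rule DERIV_minus)
    show "\<bar>- Q t - C * (x t - v t)\<bar> \<le> (c - C) + \<epsilon> + e"
      using close[of t] t by (simp add: algebra_simps abs_le_iff)
  qed (use \<rho> x \<open>0 \<le> \<rho>\<close> in \<open>auto simp: abs_le_iff\<close>)
  ultimately show ?thesis by (simp add: abs_le_iff)
qed

end

section \<open>The vanishing viscosity limit\<close>

context reaction begin

lemma potential_positive:
  assumes "0 < \<theta>"
  obtains m where "0 < m" "\<And>u. u \<in> {\<theta>..w - \<theta>} \<Longrightarrow> m \<le> C * u - F u"
proof (cases "{\<theta>..w - \<theta>} = {}")
  case False
  have "continuous_on {\<theta>..w - \<theta>} (\<lambda>u. C * u - F u)"
    using assms order by (intro continuous_intros continuous_on_subset[OF F_continuous]) auto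
  then obtain q where q: "q \<in> {\<theta>..w - \<theta>}" "\<And>u. u \<in> {\<theta>..w - \<theta>} \<Longrightarrow> C * q - F q \<le> C * u - F u"
    using continuous_attains_inf[of "{\<theta>..w - \<theta>}" "\<lambda>u. C * u - F u"] False by auto
  have "0 < C * q - F q" using below[of q] q(1) assms by auto
  then show thesis using that q(2) by blast
qed (use that[of 1] in auto)

lemma square_ratio_tendsto_0:
  "((\<lambda>\<epsilon>::real. (\<epsilon> / \<eta>)\<^sup>2) \<longlongrightarrow> 0) (at_right 0)"
proof -
  have "((\<lambda>\<epsilon>. (\<epsilon> / \<eta>)\<^sup>2) \<longlongrightarrow> (0 / \<eta>)\<^sup>2) (at_right (0::real))"
    unfolding divide_inverse by (intro tendsto_intros)
  then show ?thesis by simp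
qed

lemma speeds_converge:
  assumes fronts: "\<And>\<epsilon>. 0 < \<epsilon> \<Longrightarrow> front f \<alpha> s w \<epsilon> (c \<epsilon>) (v \<epsilon>)"
  shows "(c \<longlongrightarrow> C) (at_right 0)"
proof (rule order_tendstoI)
  have pos: "\<forall>\<^sub>F \<epsilon> in at_right (0::real). 0 < \<epsilon>" by (simp add: eventually_at_right_less)
  show "\<forall>\<^sub>F \<epsilon> in at_right 0. a < c \<epsilon>" if "a < C" for a
    using pos by eventually_elim (use front.speed_lower[OF fronts] that in force)
  show "\<forall>\<^sub>F \<epsilon> in at_right 0. c \<epsilon> < b" if "C < b" for b
  proof -
    define \<delta> where "\<delta> = b - C"
    define \<eta> where "\<eta> = \<delta> * \<alpha> / 2"
    have \<delta>: "0 < \<delta>" using that by (simp add: \<delta>_def)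
    have al: "0 < \<alpha>" using order by simp
    note k = square_ratio_tendsto_0[of \<eta>]
    have "\<forall>\<^sub>F \<epsilon> in at_right 0. (\<epsilon> / \<eta>)\<^sup>2 < \<alpha> / 4"
      using al by (intro order_tendstoD(2)[OF k]) auto
    moreover have "((\<lambda>\<epsilon>. C * (\<epsilon> / \<eta>)\<^sup>2 + \<epsilon>) \<longlongrightarrow> C * 0 + 0) (at_right 0)"
      by (intro tendsto_intros k)
    then have "\<forall>\<^sub>F \<epsilon> in at_right 0. C * (\<epsilon> / \<eta>)\<^sup>2 + \<epsilon> < \<alpha> * \<delta> / 4"
      using al \<delta> by (intro order_tendstoD(2)) auto
    ultimately show ?thesis using pos
    proof eventually_elim
      case (elim \<epsilon>)
      then show ?case
        using front.speed_upper[OF fronts[OF elim(3)] \<delta> \<eta>_def] by (simp add: \<delta>_def)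
    qed
  qed
qed

text \<open>Here \<open>max 0 (z + \<alpha>)\<close> is the linear branch \<open>V_L z 0 \<alpha>\<close>, which stays below \<open>1\<close> for
  \<open>z \<le> w - \<alpha>\<close>.\<close>

lemma profiles_converge:
  assumes fronts: "\<And>\<epsilon>. 0 < \<epsilon> \<Longrightarrow> front f \<alpha> s w \<epsilon> (c \<epsilon>) (v \<epsilon>)"
    and x: "\<And>z. (x has_real_derivative f (x z) / C) (at z)" "x (w - \<alpha>) = w"
    and x_range: "\<And>z. w - \<alpha> \<le> z \<Longrightarrow> w \<le> x z \<and> x z \<le> 1"
  shows "uniform_limit UNIV v (\<lambda>z. if z \<le> w - \<alpha> then max 0 (z + \<alpha>) else x z) (at_right 0)"
proof (rule uniform_limitI)
  fix r :: real assume r: "0 < r"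
  have "\<exists>q\<in>{0..1}. \<forall>u\<in>{0..1}. f u \<le> f q"
    using cont by (intro continuous_attains_sup) auto
  then obtain M where M: "\<And>u. u \<in> {0..1} \<Longrightarrow> f u \<le> M" by blast
  have M0: "0 \<le> M" using M[of 0] zero[of 0] order by simp
  \<comment> \<open>As \<open>\<epsilon>\<close> tends to \<open>0\<close>, the bound from \<open>right_estimate\<close> tends to \<open>\<theta> * B\<close>.\<close>
  define B where "B = 1 + 2 * (1 + M) / C"
  have B: "0 < B" using M0 C_pos by (simp add: B_def add_pos_nonneg)
  define \<theta> where "\<theta> = Min {\<alpha>, w - \<alpha>, (w - s) / 2, r / 2, r / (2 * B)}"
  have "\<theta> \<in> {\<alpha>, w - \<alpha>, (w - s) / 2, r / 2, r / (2 * B)}"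
    unfolding \<theta>_def by (rule Min_in) auto
  then have "0 < \<theta>" using order r B by auto
  moreover have "\<theta> \<le> \<alpha>" "\<theta> \<le> w - \<alpha>" "\<theta> \<le> (w - s) / 2" "\<theta> \<le> r / 2" "\<theta> \<le> r / (2 * B)"
    unfolding \<theta>_def by (rule Min_le; simp)+
  ultimately have \<theta>: "0 < \<theta>" "\<theta> \<le> \<alpha>" "\<theta> \<le> w - \<alpha>" "\<theta> \<le> (w - s) / 2" "\<theta> \<le> r / 2" "\<theta> \<le> r / (2 * B)"
    by blast+
  have "\<theta> * B \<le> r / 2" using \<theta>(6) B by (simp add: field_simps)
  then have \<theta>B: "\<theta> * B < r" using r by simp
  obtain m where m: "0 < m" "\<And>u. u \<in> {\<theta>..w - \<theta>} \<Longrightarrow> m \<le> C * u - F u"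
    using potential_positive[OF \<theta>(1)] by blast
  define k where "k \<epsilon> = (\<epsilon> / (m / 2))\<^sup>2" for \<epsilon>
  define j where "j \<epsilon> = (\<epsilon> / (\<theta> / 2))\<^sup>2" for \<epsilon>
  define \<rho> where "\<rho> \<epsilon> = \<theta> + 2 * k \<epsilon>" for \<epsilon>
  define e where "e \<epsilon> = (c \<epsilon> - C) + \<theta> + M * \<rho> \<epsilon>" for \<epsilon>
  have k: "(k \<longlongrightarrow> 0) (at_right 0)" and j: "(j \<longlongrightarrow> 0) (at_right 0)"
    unfolding k_def[abs_def] j_def[abs_def] by (rule square_ratio_tendsto_0)+
  have c: "(c \<longlongrightarrow> C) (at_right 0)" by (rule speeds_converge[OF fronts])
  have \<rho>: "(\<rho> \<longlongrightarrow> \<theta> + 2 * 0) (at_right 0)"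
    unfolding \<rho>_def[abs_def] by (intro tendsto_intros k)
  have e: "(e \<longlongrightarrow> (C - C) + \<theta> + M * (\<theta> + 2 * 0)) (at_right 0)"
    unfolding e_def[abs_def] by (intro tendsto_intros c \<rho>)
  have "((\<lambda>\<epsilon>. c \<epsilon> * k \<epsilon> + \<epsilon>) \<longlongrightarrow> C * 0 + 0) (at_right 0)" by (intro tendsto_intros c k)
  then have ev1: "\<forall>\<^sub>F \<epsilon> in at_right 0. c \<epsilon> * k \<epsilon> + \<epsilon> < m / 2"
    using m by (intro order_tendstoD(2)) auto
  have "((\<lambda>\<epsilon>. c \<epsilon> * j \<epsilon>) \<longlongrightarrow> C * 0) (at_right 0)" by (intro tendsto_intros c j)
  then have ev2: "\<forall>\<^sub>F \<epsilon> in at_right 0. c \<epsilon> * j \<epsilon> < \<theta> / 2"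
    using \<theta> by (intro order_tendstoD(2)) auto
  have ev3: "\<forall>\<^sub>F \<epsilon> in at_right 0. k \<epsilon> < 1 / 2" "\<forall>\<^sub>F \<epsilon> in at_right 0. j \<epsilon> < 1 / 2"
    by (intro order_tendstoD(2)[OF k] order_tendstoD(2)[OF j]; simp)+
  have ev4: "\<forall>\<^sub>F \<epsilon> in at_right 0. \<rho> \<epsilon> < r" "\<forall>\<^sub>F \<epsilon> in at_right 0. \<rho> \<epsilon> < w - s"
    using \<theta> r order by (intro order_tendstoD(2)[OF \<rho>]; simp add: field_simps)+
  have "((\<lambda>\<epsilon>. \<rho> \<epsilon> + 2 * ((c \<epsilon> - C) + \<epsilon> + e \<epsilon>) / C) \<longlongrightarrow>
      (\<theta> + 2 * 0) + 2 * ((C - C) + 0 + ((C - C) + \<theta> + M * (\<theta> + 2 * 0))) / C) (at_right 0)"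
    using C_pos by (intro tendsto_intros c \<rho> e) auto
  moreover have "(\<theta> + 2 * 0) + 2 * ((C - C) + 0 + ((C - C) + \<theta> + M * (\<theta> + 2 * 0))) / C = \<theta> * B"
    using C_pos by (simp add: B_def field_simps)
  ultimately have ev5: "\<forall>\<^sub>F \<epsilon> in at_right 0. \<rho> \<epsilon> + 2 * ((c \<epsilon> - C) + \<epsilon> + e \<epsilon>) / C < r"
    using \<theta>B by (intro order_tendstoD(2)) auto
  have "\<forall>\<^sub>F \<epsilon> in at_right (0::real). 0 < \<epsilon>" by (simp add: eventually_at_right_less)
  with ev1 ev2 ev3 ev4 ev5
  show "\<forall>\<^sub>F \<epsilon> in at_right 0. \<forall>z\<in>UNIV. dist (v \<epsilon> z) (if z \<le> w - \<alpha> then max 0 (z + \<alpha>) else x z) < r"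
  proof eventually_elim
    case (elim \<epsilon>)
    then interpret front f \<alpha> s w \<epsilon> "c \<epsilon>" "v \<epsilon>" by (intro fronts)
    have slope: "1 - deriv (v \<epsilon>) z \<le> k \<epsilon>" if "v \<epsilon> z \<in> {\<theta>..w - \<theta>}" for z
      using slope_estimate[OF \<theta>(1,2) m _ that] elim by (simp add: k_def)
    have k0: "0 \<le> k \<epsilon>" by (simp add: k_def)
    have left: "\<bar>v \<epsilon> z - max 0 (z + \<alpha>)\<bar> \<le> \<rho> \<epsilon>" if "z \<le> w - \<alpha>" for z
      unfolding \<rho>_def using elim \<theta> k0 that by (intro left_estimate[OF slope]) auto
    have start: "\<bar>v \<epsilon> (w - \<alpha>) - w\<bar> \<le> \<rho> \<epsilon>" using left[of "w - \<alpha>"] order by simp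
    have small: "energy z \<le> e \<epsilon>" if "w - \<alpha> \<le> z" for z
    proof (cases "w \<le> v \<epsilon> z")
      case True
      have "energy z \<le> \<theta>" using elim by (intro energy_past_w[OF \<theta>(1) _ _ True]) (auto simp: j_def)
      moreover have "0 \<le> M * \<rho> \<epsilon>" using M0 \<theta> k0 by (simp add: \<rho>_def)
      ultimately show ?thesis using speed_lower by (simp add: e_def)
    next
      case False
      have "M * (w - v \<epsilon> z) \<le> M * \<rho> \<epsilon>"
        using start v_mono[OF that] M0 by (intro mult_left_mono) (auto simp: abs_le_iff)
      then show ?thesis using energy_before_w[OF M, of z] False \<theta> by (simp add: e_def)
    qed
    have right: "\<bar>v \<epsilon> z - x z\<bar> \<le> \<rho> \<epsilon> + 2 * ((c \<epsilon> - C) + \<epsilon> + e \<epsilon>) / C" if "w - \<alpha> \<le> z" for z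
      using elim by (intro right_estimate[OF x x_range start _ small that]) auto
    show ?case
    proof
      fix z
      show "dist (v \<epsilon> z) (if z \<le> w - \<alpha> then max 0 (z + \<alpha>) else x z) < r"
        using left[of z] right[of z] elim by (auto simp: dist_real_def)
    qed
  qed
qed

end

theorem theorem31:
  fixes f :: "real \<Rightarrow> real" and k \<alpha> :: real and v :: "real \<Rightarrow> real \<Rightarrow> real"
  assumes "continuous_on {0..1} f"
    and "f 0 = 0" and "f 1 = 0"
    and "k > 0"
    and "\<forall>s\<in>{0..1}. \<bar>f s\<bar> \<le> k * s \<and> \<bar>f s\<bar> \<le> k * (1 - s)"
    and "type_B f \<alpha>"
    and "local_lipschitz (UNIV :: real set) {\<alpha>..1} (\<lambda>_. f)"
    and "\<exists>!s. s \<in> {\<alpha><..<1} \<and> local_max_point f s"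
    and "\<forall>\<epsilon>>0. critical_profile f \<epsilon> (v \<epsilon>) \<and> v \<epsilon> 0 = \<alpha>"
  shows "\<exists>v_plus. largest_solution f v_plus \<and>
           (critical_speed f \<longlongrightarrow> f v_plus) (at_right 0) \<and>
           uniform_limit UNIV v (limit_profile f \<alpha> v_plus) (at_right 0)"
proof -
  from assms(8) obtain s where s: "s \<in> {\<alpha><..<1}" "\<And>u. u \<in> {\<alpha><..<1} \<Longrightarrow> local_max_point f u \<Longrightarrow> u = s"
    by blast
  obtain w where R: "reaction f \<alpha> s w" and w: "largest_solution f w"
    using reaction_exists[OF assms(1,3,6) s] by blast
  interpret reaction f \<alpha> s w by (rule R)
  have fronts: "front f \<alpha> s w \<epsilon> (critical_speed f \<epsilon>) (v \<epsilon>)" if "0 < \<epsilon>" for \<epsilon>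
    using assms(9) that by unfold_locales (auto simp: critical_profile_def)
  have speed: "(critical_speed f \<longlongrightarrow> C) (at_right 0)" by (rule speeds_converge[OF fronts])
  then have inviscid: "inviscid_speed f = C"
    unfolding inviscid_speed_def by (intro tendsto_Lim) auto
  have "local_lipschitz {0::real} {\<alpha>..1} (\<lambda>_. f)" by (rule local_lipschitz_subset[OF assms(7)]) auto
  then obtain L where "\<And>t. t \<in> {0::real} \<Longrightarrow> L-lipschitz_on {\<alpha>..1} f"
    by (rule local_lipschitz_compact_implies_lipschitz) auto
  then have "L-lipschitz_on {\<alpha>..1} f" by simp
  then have L: "0 \<le> L" and lip: "\<bar>f a - f b\<bar> \<le> L * \<bar>a - b\<bar>" if "a \<in> {\<alpha>..1}" "b \<in> {\<alpha>..1}" for a b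
    using that by (auto simp: lipschitz_on_def dist_real_def)
  have L0: "0 \<le> L" using L[of 1 1] order by simp
  \<comment> \<open>On \<open>[0, \<alpha>]\<close> the function is constant, so the Lipschitz bound extends to \<open>[0, 1]\<close>.\<close>
  have lip01: "L-lipschitz_on {0..1} f"
  proof (rule lipschitz_onI[OF _ L0])
    fix a b :: real assume ab: "a \<in> {0..1}" "b \<in> {0..1}"
    have below_al: "f t = f (max t \<alpha>)" if "t \<in> {0..1}" for t
      using zero[of t] zero[of \<alpha>] that order by (auto simp: max_def)
    have "\<bar>f (max a \<alpha>) - f (max b \<alpha>)\<bar> \<le> L * \<bar>max a \<alpha> - max b \<alpha>\<bar>"
      using ab order by (intro lip) auto
    also have "\<dots> \<le> L * \<bar>a - b\<bar>" using L0 by (intro mult_left_mono) (auto simp: max_def)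
    finally show "dist (f a) (f b) \<le> L * dist a b"
      using below_al ab by (simp add: dist_real_def)
  qed
  obtain x where x: "\<And>z. x z \<in> {\<alpha><..<1}" "x (w - \<alpha>) = w"
      "\<And>z. (x has_real_derivative f (x z) / C) (at z)"
  proof (rule inviscid_solution_exists[of \<alpha> 1 f L w C "w - \<alpha>"])
    show "continuous_on {\<alpha><..<1} f" using cont order by (auto intro: continuous_on_subset)
    fix u assume u: "u \<in> {\<alpha><..<1}"
    show "f u \<le> L * (u - \<alpha>)" using lip[of u \<alpha>] u zero[of \<alpha>] order by auto
    show "f u \<le> L * (1 - u)" using lip[of u 1] u right_end order by auto
  qed (use pos order C_pos in auto)
  have sol: "inviscid_solution f C (w - \<alpha>) w x"
    unfolding inviscid_solution_def
  proof (intro conjI allI)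
    show "x differentiable (at z)" "C * deriv x z = f (x z)" for z
      using x(3)[of z] C_pos by (auto simp: real_differentiable_def DERIV_imp_deriv)
    show "0 < x z" "x z \<le> 1" for z using x(1)[of z] order by auto
  qed (rule x(2))
  have "(THE y. inviscid_solution f C (w - \<alpha>) w y) = x"
    by (rule the_equality) (use sol inviscid_solution_unique[OF lip01 C_pos _ sol] in blast)+
  then have V_I: "V_I f z (w - \<alpha>) w = x z" for z by (simp add: V_I_def inviscid)
  have range: "w \<le> x z \<and> x z \<le> 1" if "w - \<alpha> \<le> z" for z
  proof -
    have "x (w - \<alpha>) \<le> x z"
    proof (rule DERIV_nonneg_imp_nondecreasing[OF that])
      show "\<exists>y. (x has_real_derivative y) (at t) \<and> 0 \<le> y" for t
        using x(3)[of t] pos[OF x(1)[of t]] C_pos by (intro exI[of _ "f (x t) / C"]) auto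
    qed
    then show ?thesis using x(1)[of z] x(2) by auto
  qed
  have "limit_profile f \<alpha> w = (\<lambda>z. if z \<le> w - \<alpha> then max 0 (z + \<alpha>) else x z)"
    using order by (auto simp: fun_eq_iff limit_profile_def V_L_def V_I)
  then have "uniform_limit UNIV v (limit_profile f \<alpha> w) (at_right 0)"
    using profiles_converge[OF fronts x(3,2) range] by simp
  then show ?thesis using w speed by blast
qed

end
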